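(* Let $q$ be a prime power and $k,m$ positive integers with $(k-1)m$ even. Let $W$ be a $(k-1)$-dimensional $\mathbb{F}_{q^m}$-subspace of $\mathbb{F}_{q^m}^k$, $H=\mathrm{PG}(W,\mathbb{F}_{q^m})$, and $U'\subseteq W$ an $\mathbb{F}_q$-subspace with $L_{U'}$ a maximum scattered $\mathbb{F}_q$-linear set in $H$. Let $x\in\mathbb{F}_{q^m}^k$ with $\langle x\rangle_{\mathbb{F}_{q^m}}\cap W=\{0\}$, let $i\ge m/2$ be a positive integer, $U''$ an $i$-dimensional $\mathbb{F}_q$-subspace of $\langle x\rangle_{\mathbb{F}_{q^m}}$, and $U=U'+U''$. Then for every hyperplane $\Omega$ of $\mathrm{PG}(k-1,q^m)$, \[ w_{L_U}(\Omega)\in\left\{\frac{m(k-1)}{2},\ \frac{m(k-3)}{2},\ \frac{m(k-3)}{2}+1,\ \ldots,\ \frac{m(k-3)}{2}+i+1\right\},\] and there exists a hyperplane of weight $\frac{m(k-1)}{2}$.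
   Context: For an $\mathbb{F}_q$-subspace $U$ of $\mathbb{F}_{q^m}^k$, $L_U=\{\langle u\rangle_{\mathbb{F}_{q^m}} : u\in U\setminus\{0\}\}$; for an $\mathbb{F}_{q^m}$-subspace $T$, $w_{L_U}(\mathrm{PG}(T,\mathbb{F}_{q^m}))=\dim_{\mathbb{F}_q}(U\cap T)$. $L_U$ is scattered if all its points have weight $1$. For an $r$-dimensional $\mathbb{F}_{q^m}$-subspace $W$, $L_{U'}$ with $U'\subseteq W$ is maximum scattered in $\mathrm{PG}(W,\mathbb{F}_{q^m})$ if it is scattered and $\dim_{\mathbb{F}_q}U'=rm/2$. *)

theory Defs
  imports "HOL-Analysis.Analysis" "HOL-Number_Theory.Prime_Powers"
begin

text \<open>
  The field extension $F_{q^m}/F_q$ is given by two finite field types and an embedding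
  \<open>e\<close> of the smaller field into the larger one. A subspace $PG(T)$ of the projective space is
  represented by the underlying linear subspace \<open>T\<close>; points are the one-dimensional ones.
\<close>

definition field_embedding :: "('q::field \<Rightarrow> 'a::field) \<Rightarrow> bool" where
  "field_embedding e \<longleftrightarrow>
     e 1 = 1 \<and> (\<forall>x y. e (x + y) = e x + e y) \<and> (\<forall>x y. e (x * y) = e x * e y)"

definition scale_via :: "('q::field \<Rightarrow> 'a::field) \<Rightarrow> 'q \<Rightarrow> 'a ^ 'n \<Rightarrow> 'a ^ 'n" where
  "scale_via e c v = e c *s v"

lemma vector_space_scale_via:
  assumes "field_embedding e"
  shows "vector_space (scale_via e :: 'q::field \<Rightarrow> 'a::field ^ 'n \<Rightarrow> 'a ^ 'n)"
  using assms
  by unfold_locales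
    (simp_all add: field_embedding_def scale_via_def vec_eq_iff algebra_simps)

abbreviation Fq_subspace :: "('q::field \<Rightarrow> 'a::field) \<Rightarrow> ('a ^ 'n) set \<Rightarrow> bool" where
  "Fq_subspace e \<equiv> module.subspace (scale_via e)"

abbreviation Fq_dim :: "('q::field \<Rightarrow> 'a::field) \<Rightarrow> ('a ^ 'n) set \<Rightarrow> nat" where
  "Fq_dim e \<equiv> vector_space.dim (scale_via e)"

definition linear_set :: "('a::field ^ 'n) set \<Rightarrow> ('a ^ 'n) set set" where
  "linear_set U = {vec.span {u} | u. u \<in> U - {0}}"

definition weight :: "('q::field \<Rightarrow> 'a::field) \<Rightarrow> ('a ^ 'n) set \<Rightarrow> ('a ^ 'n) set \<Rightarrow> nat" where
  "weight e U T = Fq_dim e (U \<inter> T)"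

definition scattered :: "('q::field \<Rightarrow> 'a::field) \<Rightarrow> ('a ^ 'n) set \<Rightarrow> bool" where
  "scattered e U \<longleftrightarrow> (\<forall>P \<in> linear_set U. weight e U P = 1)"

definition maximum_scattered_in ::
    "('q::field \<Rightarrow> 'a::field) \<Rightarrow> nat \<Rightarrow> ('a ^ 'n) set \<Rightarrow> ('a ^ 'n) set \<Rightarrow> bool" where
  "maximum_scattered_in e m W U \<longleftrightarrow>
     Fq_subspace e U \<and> U \<subseteq> W \<and> scattered e U \<and>
     real (Fq_dim e U) = real (vec.dim W) * real m / 2"

definition proj_hyperplane :: "('a::field ^ 'n) set \<Rightarrow> bool" where
  "proj_hyperplane T \<longleftrightarrow> vec.subspace T \<and> vec.dim T = CARD('n) - 1"

end

theory Submission
  imports Defs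
begin

text \<open>
  The hyperplane \<open>W\<close> meets \<open>U\<close> in \<open>U'\<close>, which gives the weight $m(k-1)/2$. For any other
  hyperplane, given by a functional $f$, put $n = |U'| = q^d$, $Q = q^m$ and
  $X_f = |U' \cap \ker f|$, so $Q^{k-1} = n^2$. Double counting of pairs in \<open>U'\<close> (scatteredness
  says that each point meets \<open>U'\<close> in exactly $q$ vectors) shows that
  $\sum_f (Q X_f - n)(Q X_f - q n)$ over all functionals equals the contribution of the $Q$
  functionals vanishing on \<open>W\<close>. Each summand is nonnegative because $X_f$ is a power of $q$ and
  $Q X_f \ge n$, so all the others vanish: $\dim (U' \cap \ker f) \in \{d - m, d - m + 1\}$.
  Projecting $U \cap \ker f$ onto \<open>U''\<close> adds between $0$ and $i$.
\<close>

section \<open>Linear functionals and hyperplanes\<close>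

text \<open>A functional is encoded by its coefficient vector, so the functionals form the type
  \<open>'a ^ 'n\<close> itself: they can be summed over, counted, and collected into
  subspaces.\<close>

definition dotp :: "'a::field ^ 'n \<Rightarrow> 'a ^ 'n \<Rightarrow> 'a" where
  "dotp f u = (\<Sum>j\<in>UNIV. f $ j * u $ j)"

lemma dotp_add_left: "dotp (f + g) u = dotp f u + dotp g u"
  and dotp_add_right: "dotp f (u + v) = dotp f u + dotp f v"
  and dotp_diff_left: "dotp (f - g) u = dotp f u - dotp g u"
  and dotp_diff_right: "dotp f (u - v) = dotp f u - dotp f v"
  and dotp_scale_left: "dotp (c *s f) u = c * dotp f u"
  and dotp_scale_right: "dotp f (c *s u) = c * dotp f u"
  and dotp_zero_left [simp]: "dotp 0 u = 0"
  and dotp_zero_right [simp]: "dotp f 0 = 0"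
  by (simp_all add: dotp_def algebra_simps sum.distrib sum_subtractf sum_distrib_left)

lemma subspace_kernel_dotp: "vec.subspace {u. dotp f u = 0}"
  by (auto simp: vec.subspace_def dotp_add_right dotp_scale_right)

text \<open>A basis of \<open>S\<close> stays independent when \<open>y\<close> is adjoined, so a
  linear map may be prescribed to be 0 on that basis and nonzero at \<open>y\<close>.\<close>

lemma separating_functional_exists:
  fixes S :: "('a::field ^ 'n) set"
  assumes S: "vec.subspace S" and y: "y \<notin> S"
  obtains f where "\<And>s. s \<in> S \<Longrightarrow> dotp f s = 0" and "dotp f y = 1"
proof -
  obtain B where B: "B \<subseteq> S" "vec.independent B" "vec.span B = S"
    using vec.basis_subspace_exists[OF S] by blast
  have "vec.independent (insert y B)"
    using B y by (simp add: vec.independent_insertI)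
  from vec.linear_independent_extend[OF this, of "\<lambda>b. if b = y then 1 else 0"]
  obtain g where g: "Vector_Spaces.linear (*s) (*s) g"
    and gB: "\<forall>b\<in>insert y B. g b = (if b = y then 1 else (0 :: 'a ^ 'n))"
    by blast
  \<comment> \<open>The value \<open>1\<close> prescribed at \<open>y\<close> is the all-ones
    vector, so every coordinate of \<open>g\<close> sends \<open>y\<close> to the scalar 1 and any
    index serves.\<close>
  obtain j :: 'n where True by blast
  define f where "f = matrix g $ j"
  have f: "dotp f u = g u $ j" for u
    using matrix_works[OF g, of u] unfolding f_def dotp_def
    by (simp add: matrix_vector_mult_def vec_eq_iff)
  have "g s = 0" if "s \<in> S" for s
  proof -
    have "g b = 0" if "b \<in> B" for b
      using gB B y that by auto
    then show ?thesis
      using vec.linear_eq_0_on_span[OF g, of B s] that B by blast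
  qed
  then show ?thesis
    using that[of f] f gB by simp
qed

text \<open>A functional vanishing on \<open>S\<close> but not at an outside vector \<open>y\<close>
  has a proper kernel containing \<open>S\<close>. A proper subspace has dimension at most
  \<open>CARD('n) - 1\<close>, which \<open>S\<close> already attains.\<close>

lemma hyperplane_eq_kernel:
  fixes S :: "('a::field ^ 'n) set"
  assumes S: "proj_hyperplane S"
  obtains f where "S = {u. dotp f u = 0}" and "f \<noteq> 0"
proof -
  have sub: "vec.subspace S" and dim: "vec.dim S = CARD('n) - 1"
    using S by (auto simp: proj_hyperplane_def)
  \<comment> \<open>The truncated difference \<open>CARD('n) - 1\<close> lies strictly below
    \<open>CARD('n)\<close> because index types are nonempty.\<close>
  have "S \<noteq> UNIV"
    using dim vec_dim_card[where ?'n = 'n and ?'a = 'a] zero_less_card_finite[where ?'a = 'n]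
    by (metis diff_less less_irrefl zero_less_one)
  then obtain y where y: "y \<notin> S" by auto
  obtain f where f: "\<And>s. s \<in> S \<Longrightarrow> dotp f s = 0" "dotp f y = 1"
    using separating_functional_exists[OF sub y] by blast
  have "vec.dim {u. dotp f u = 0} \<le> vec.dim S"
  proof -
    have "y \<notin> vec.span {u. dotp f u = 0}"
      using f subspace_kernel_dotp by (metis mem_Collect_eq vec.span_eq_iff zero_neq_one)
    then have "vec.dim {u. dotp f u = 0} + 1 = vec.dim (insert y {u. dotp f u = 0})"
      by (simp add: vec.dim_insert)
    also have "\<dots> \<le> CARD('n)"
      using vec.dim_subset[OF subset_UNIV, of "insert y {u. dotp f u = 0}"]
      by (simp only: vec_dim_card)
    finally show ?thesis using dim by simp
  qed
  then have "S = {u. dotp f u = 0}"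
    using f by (intro vec.subspace_dim_equal[OF sub subspace_kernel_dotp]) auto
  moreover have "f \<noteq> 0" using f by auto
  ultimately show ?thesis by (rule that)
qed

section \<open>Cardinalities of subspaces and of fibres\<close>

text \<open>Each new basis vector \<open>b\<close> contributes one factor \<open>CARD('a)\<close>:
  the elements of the larger span are uniquely \<open>c *s b + y\<close> with \<open>y\<close> in
  the smaller span.\<close>

lemma (in vector_space) card_span_independent:
  assumes "independent B" and "finite B" and fin: "finite (UNIV :: 'a set)"
  shows "finite (span B) \<and> card (span B) = CARD('a) ^ card B"
  using assms(2,1)
proof (induction B rule: finite_induct)
  case empty
  then show ?case by simp
next
  case (insert b B)
  have b: "b \<notin> span B" and ind: "independent B"
    using insert by (auto simp: independent_insert)
  have IH: "finite (span B)" "card (span B) = CARD('a) ^ card B"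
    using insert.IH[OF ind] by auto
  let ?h = "\<lambda>(c, y). c *s b + y"
  have inj: "inj_on ?h (UNIV \<times> span B)"
  proof (rule inj_onI, clarify)
    fix c y c' y'
    assume y: "y \<in> span B" "y' \<in> span B" and eq: "c *s b + y = c' *s b + y'"
    have "(c - c') *s b = y' - y"
      using eq by (simp add: scale_left_diff_distrib) (simp add: algebra_simps)
    then have mem: "(c - c') *s b \<in> span B"
      using y by (simp add: span_diff)
    have "c - c' = 0"
    proof (rule ccontr)
      assume nz: "c - c' \<noteq> 0"
      have "inverse (c - c') *s ((c - c') *s b) \<in> span B"
        using mem by (rule span_scale)
      with nz b show False by simp
    qed
    with eq show "c = c' \<and> y = y'" by simp
  qed
  have im: "?h ` (UNIV \<times> span B) = span (insert b B)"
  proof (intro subset_antisym subsetI)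
    fix z assume "z \<in> span (insert b B)"
    then obtain c where "z - c *s b \<in> span B"
      by (auto simp: span_breakdown_eq)
    then show "z \<in> ?h ` (UNIV \<times> span B)"
      by (intro image_eqI[of _ _ "(c, z - c *s b)"]) auto
  next
    fix z assume "z \<in> ?h ` (UNIV \<times> span B)"
    then obtain c y where "z = c *s b + y" "y \<in> span B" by auto
    then show "z \<in> span (insert b B)"
      by (auto simp: span_breakdown_eq intro!: exI[of _ c])
  qed
  have "card (span (insert b B)) = card (UNIV \<times> span B :: ('a \<times> 'b) set)"
    using im card_image[OF inj] by simp
  then show ?case
    using IH insert.hyps im fin
    by (metis card_cartesian_product card_insert_disjoint finite_SigmaI finite_imageI power_Suc)
qed

text \<open>The bridge between weights and counting: weights become exponents of
  \<open>CARD('q)\<close>, and inequalities between them are read off from cardinalities.\<close>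

lemma card_Fq_subspace:
  fixes e :: "'q::{field,finite} \<Rightarrow> 'a::{field,finite}" and S :: "('a ^ 'n) set"
  assumes e: "field_embedding e" and S: "Fq_subspace e S"
  shows "card S = CARD('q) ^ Fq_dim e S"
proof -
  interpret F: vector_space "scale_via e :: 'q \<Rightarrow> 'a ^ 'n \<Rightarrow> 'a ^ 'n"
    by (rule vector_space_scale_via[OF e])
  obtain B where B: "B \<subseteq> S" "F.independent B" "S \<subseteq> F.span B" "card B = F.dim S"
    using F.basis_exists by blast
  have "F.span B = S"
    using B S by (metis F.span_minimal subset_antisym)
  then show ?thesis
    using F.card_span_independent[of B] B by simp
qed

lemma Fq_subspace_inter:
  assumes "field_embedding e" and "Fq_subspace e S" and "Fq_subspace e T"
  shows "Fq_subspace e (S \<inter> T)"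
proof -
  interpret F: vector_space "scale_via e"
    by (rule vector_space_scale_via[OF assms(1)])
  show ?thesis using assms F.subspace_inter by blast
qed

lemma Fq_subspace_of_subspace:
  fixes S :: "('a::field ^ 'n) set"
  assumes e: "field_embedding e" and S: "vec.subspace S"
  shows "Fq_subspace e S"
proof -
  interpret F: vector_space "scale_via e :: _ \<Rightarrow> 'a ^ 'n \<Rightarrow> _"
    by (rule vector_space_scale_via[OF e])
  show ?thesis
    using S by (auto simp: F.subspace_def vec.subspace_def scale_via_def)
qed

text \<open>The fibres of \<open>h\<close> partition \<open>A\<close>, and subtracting a fixed
  element of a fibre injects that fibre into the kernel.\<close>

lemma card_le_card_kernel_mult_card_image:
  fixes h :: "'b::ab_group_add \<Rightarrow> 'c::ab_group_add"
  assumes A: "finite A" "\<And>x y. x \<in> A \<Longrightarrow> y \<in> A \<Longrightarrow> x - y \<in> A"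
    and h: "\<And>x y. h (x - y) = h x - h y"
  shows "card A \<le> card {x \<in> A. h x = 0} * card (h ` A)"
proof -
  have "card {x \<in> A. h x = b} \<le> card {x \<in> A. h x = 0}" if b: "b \<in> h ` A" for b
  proof -
    obtain a where a: "a \<in> A" "h a = b" using b by auto
    show ?thesis
      using A a by (intro card_inj_on_le[where f = "\<lambda>x. x - a"]) (auto simp: h inj_on_def)
  qed
  moreover have "card A = (\<Sum>b\<in>h ` A. card {x \<in> A. h x = b})"
    using A(1) sum.image_gen[of A "\<lambda>_. 1::nat" h] by simp
  ultimately show ?thesis
    using sum_bounded_above[of "h ` A" "\<lambda>b. card {x \<in> A. h x = b}" "card {x \<in> A. h x = 0}"]
    by (simp add: mult.commute)
qed

section \<open>Counting functionals that vanish at given vectors\<close>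

text \<open>Here \<open>A\<close> is a space of functionals. Splitting off
  \<open>dotp f u *s f0\<close> writes each \<open>f\<close> in \<open>A\<close> uniquely as a
  multiple of \<open>f0\<close> plus a member of \<open>A\<close> vanishing at
  \<open>u\<close>.\<close>

lemma card_eq_CARD_mult_card_kernel:
  fixes A :: "('a::{field,finite} ^ 'n) set"
  assumes A: "vec.subspace A" and f: "f0 \<in> A" "dotp f0 u = 1"
  shows "card A = CARD('a) * card {f \<in> A. dotp f u = 0}"
proof -
  have "bij_betw (\<lambda>(c, f). c *s f0 + f) (UNIV \<times> {f \<in> A. dotp f u = 0}) A"
    using A f
    by (intro bij_betw_byWitness[where f' = "\<lambda>f. (dotp f u, f - dotp f u *s f0)"])
      (auto simp: dotp_add_left dotp_diff_left dotp_scale_left vec.subspace_add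
        vec.subspace_diff vec.subspace_scale)
  from bij_betw_same_card[OF this] show ?thesis
    by (simp add: card_cartesian_product)
qed

lemma card_annihilator1:
  fixes u :: "'a::{field,finite} ^ 'n"
  assumes "u \<noteq> 0"
  shows "CARD('a) * card {f. dotp f u = 0} = CARD('a) ^ CARD('n)"
proof -
  obtain f where "dotp f u = 1"
    using separating_functional_exists[OF vec.subspace_single_0, of u] assms by blast
  then show ?thesis
    using card_eq_CARD_mult_card_kernel[OF vec.subspace_UNIV, of f u] by simp
qed

text \<open>Some functional vanishes on the line of \<open>u\<close> but not at \<open>v\<close>, so
  the condition at \<open>v\<close> costs a second factor \<open>CARD('a)\<close>. Keeping the
  factors on the left avoids truncated differences in the exponent.\<close>

lemma card_annihilator2:
  fixes u v :: "'a::{field,finite} ^ 'n"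
  assumes "u \<noteq> 0" and "v \<notin> vec.span {u}"
  shows "CARD('a)\<^sup>2 * card {f. dotp f u = 0 \<and> dotp f v = 0} = CARD('a) ^ CARD('n)"
proof -
  obtain f where f: "\<And>s. s \<in> vec.span {u} \<Longrightarrow> dotp f s = 0" "dotp f v = 1"
    using separating_functional_exists[OF vec.subspace_span assms(2)] by blast
  have "vec.subspace {f. dotp f u = 0}"
    by (auto simp: vec.subspace_def dotp_add_left dotp_scale_left)
  then have "card {f. dotp f u = 0} = CARD('a) * card {f \<in> {f. dotp f u = 0}. dotp f v = 0}"
    using f by (intro card_eq_CARD_mult_card_kernel) (auto simp: vec.span_base)
  with card_annihilator1[OF assms(1)] show ?thesis
    by (simp add: power2_eq_square mult.assoc)
qed

section \<open>First and second moments of the kernel sizes\<close>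

text \<open>Both sides count the triples \<open>(f, u, v)\<close> with \<open>u\<close>,
  \<open>v\<close> in \<open>U\<close> and \<open>f\<close> vanishing at both.\<close>

lemma sum_card_kernel_power2:
  fixes U :: "('a::{field,finite} ^ 'n) set"
  shows "(\<Sum>f\<in>UNIV. (real (card {u \<in> U. dotp f u = 0}))\<^sup>2) =
    (\<Sum>u\<in>U. \<Sum>v\<in>U. real (card {f. dotp f u = 0 \<and> dotp f v = 0}))"
proof -
  have card: "real (card {u \<in> U. dotp f u = 0}) = (\<Sum>u\<in>U. of_bool (dotp f u = 0))" for f
    by (simp add: of_bool_def sum.If_cases Int_def)
  have "(\<Sum>f\<in>UNIV. (real (card {u \<in> U. dotp f u = 0}))\<^sup>2) =
      (\<Sum>f\<in>UNIV. \<Sum>u\<in>U. \<Sum>v\<in>U. of_bool (dotp f u = 0 \<and> dotp f v = 0))"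
    by (simp only: card power2_eq_square sum_product of_bool_conj)
  also have "\<dots> = (\<Sum>u\<in>U. \<Sum>f\<in>UNIV. \<Sum>v\<in>U. of_bool (dotp f u = 0 \<and> dotp f v = 0))"
    by (rule sum.swap)
  also have "\<dots> = (\<Sum>u\<in>U. \<Sum>v\<in>U. \<Sum>f\<in>UNIV. of_bool (dotp f u = 0 \<and> dotp f v = 0))"
    by (intro sum.cong refl sum.swap)
  also have "\<dots> = (\<Sum>u\<in>U. \<Sum>v\<in>U. real (card {f. dotp f u = 0 \<and> dotp f v = 0}))"
    by (simp add: of_bool_def sum.If_cases Int_def)
  finally show ?thesis .
qed

lemma sum_card_kernel_swap:
  fixes U :: "('a::{field,finite} ^ 'n) set"
  shows "(\<Sum>f\<in>UNIV. real (card {u \<in> U. dotp f u = 0})) =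
    (\<Sum>u\<in>U. real (card {f. dotp f u = 0}))"
proof -
  have "(\<Sum>f\<in>UNIV. real (card {u \<in> U. dotp f u = 0})) =
      (\<Sum>f\<in>UNIV. \<Sum>u\<in>U. of_bool (dotp f u = 0))"
    by (simp add: of_bool_def sum.If_cases Int_def)
  also have "\<dots> = (\<Sum>u\<in>U. \<Sum>f\<in>UNIV. of_bool (dotp f u = 0))"
    by (rule sum.swap)
  finally show ?thesis
    by (simp add: of_bool_def sum.If_cases Int_def)
qed

text \<open>The zero vector is killed by all functionals, every other vector of \<open>U\<close> by
  a fraction 1/Q of them, where Q is \<open>CARD('a)\<close>.\<close>

lemma sum_card_kernel:
  fixes U :: "('a::{field,finite} ^ 'n) set"
  assumes "0 \<in> U"
  shows "real CARD('a) * (\<Sum>f\<in>UNIV. real (card {u \<in> U. dotp f u = 0})) =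
    real CARD('a) ^ CARD('n) * (real CARD('a) + real (card U) - 1)"
proof -
  have "real CARD('a) * (\<Sum>f\<in>UNIV. real (card {u \<in> U. dotp f u = 0})) =
      (\<Sum>u\<in>U. real (CARD('a) * card {f. dotp f u = 0}))"
    by (simp add: sum_card_kernel_swap sum_distrib_left)
  also have "\<dots> = real (CARD('a) * CARD('a ^ 'n)) +
      (\<Sum>u\<in>U - {0}. real (CARD('a) * card {f. dotp f u = 0}))"
    using assms by (subst sum.remove[of _ 0]) auto
  also have "\<dots> = real CARD('a) * real CARD('a) ^ CARD('n) +
      (\<Sum>u\<in>U - {0}. real CARD('a) ^ CARD('n))"
    using card_annihilator1 by (intro arg_cong2[where f = "(+)"] sum.cong) (auto simp flip: of_nat_mult of_nat_power)
  also have "\<dots> = real CARD('a) ^ CARD('n) * (real CARD('a) + real (card U) - 1)"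
  proof -
    have "0 < card U" using assms by (auto simp: card_gt_0_iff)
    then show ?thesis using assms by (simp add: algebra_simps of_nat_diff)
  qed
  finally show ?thesis .
qed

lemma card_scattered_inter_point:
  fixes e :: "'q::{field,finite} \<Rightarrow> 'a::{field,finite}" and U :: "('a ^ 'n) set"
  assumes "field_embedding e" and "Fq_subspace e U" and "scattered e U"
    and "u \<in> U" and "u \<noteq> 0"
  shows "card (U \<inter> vec.span {u}) = CARD('q)"
proof -
  have "weight e U (vec.span {u}) = 1"
    using assms unfolding scattered_def linear_set_def by blast
  then show ?thesis
    using card_Fq_subspace[OF assms(1)
        Fq_subspace_inter[OF assms(1,2) Fq_subspace_of_subspace[OF assms(1) vec.subspace_span]]]
    by (simp add: weight_def)
qed

text \<open>The number of functionals killing a pair \<open>(u, v)\<close> depends only on the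
  dimension of its span. For fixed nonzero \<open>u\<close>, scatteredness puts exactly q vectors
  \<open>v\<close> of \<open>U\<close> on the line of \<open>u\<close>, leaving n - q off
  it.\<close>

lemma scattered_sum_card_kernel_power2:
  fixes e :: "'q::{field,finite} \<Rightarrow> 'a::{field,finite}" and U :: "('a ^ 'n) set"
  assumes e: "field_embedding e" and U: "Fq_subspace e U" "scattered e U" "0 \<in> U"
  defines "Q \<equiv> real CARD('a)" and "q \<equiv> real CARD('q)" and "n \<equiv> real (card U)"
  shows "Q\<^sup>2 * (\<Sum>f\<in>UNIV. (real (card {u \<in> U. dotp f u = 0}))\<^sup>2) =
    Q ^ CARD('n) * (Q * (Q + n - 1) + (n - 1) * (q * Q + (n - q)))"
proof -
  define c where "c u v = real (card {f. dotp f u = 0 \<and> dotp f v = 0})" for u v :: "'a ^ 'n"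
  \<comment> \<open>For \<open>u = 0\<close> only the condition at \<open>v\<close> remains, so this
    row is the first moment.\<close>
  have row0: "Q\<^sup>2 * (\<Sum>v\<in>U. c 0 v) = Q ^ CARD('n) * (Q * (Q + n - 1))"
  proof -
    have "Q * (\<Sum>v\<in>U. c 0 v) = Q ^ CARD('n) * (Q + n - 1)"
      using sum_card_kernel[OF U(3)] by (simp add: sum_card_kernel_swap Q_def n_def c_def)
    then have "Q * (Q * (\<Sum>v\<in>U. c 0 v)) = Q * (Q ^ CARD('n) * (Q + n - 1))"
      by (rule arg_cong)
    then show ?thesis
      by (simp only: power2_eq_square mult.assoc mult.left_commute)
  qed
  have row: "Q\<^sup>2 * (\<Sum>v\<in>U. c u v) = Q ^ CARD('n) * (q * Q + (n - q))" if u: "u \<in> U" "u \<noteq> 0" for u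
  proof -
    have card: "card (U \<inter> vec.span {u}) = CARD('q)"
      by (rule card_scattered_inter_point[OF e U(1,2) u])
    have c1: "Q\<^sup>2 * c u v = Q * Q ^ CARD('n)" if "v \<in> vec.span {u}" for v
    proof -
      have "{f. dotp f u = 0 \<and> dotp f v = 0} = {f. dotp f u = 0}"
        using that by (auto simp: vec.span_singleton dotp_scale_right)
      moreover have "Q * real (card {f. dotp f u = 0}) = Q ^ CARD('n)"
        unfolding Q_def using card_annihilator1[OF u(2)] by (metis of_nat_mult of_nat_power)
      ultimately show ?thesis
        by (simp add: c_def power2_eq_square)
    qed
    have c2: "Q\<^sup>2 * c u v = Q ^ CARD('n)" if "v \<notin> vec.span {u}" for v
    proof -
      have "real (CARD('a)\<^sup>2 * card {f. dotp f u = 0 \<and> dotp f v = 0}) = real (CARD('a) ^ CARD('n))"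
        by (simp only: card_annihilator2[OF u(2) that])
      then show ?thesis
        by (simp only: Q_def c_def of_nat_mult of_nat_power)
    qed
    have "Q\<^sup>2 * (\<Sum>v\<in>U. c u v) = (\<Sum>v\<in>U. Q\<^sup>2 * c u v)"
      by (simp add: sum_distrib_left)
    also have "\<dots> = (\<Sum>v\<in>U \<inter> vec.span {u}. Q\<^sup>2 * c u v) + (\<Sum>v\<in>U - vec.span {u}. Q\<^sup>2 * c u v)"
      by (subst sum.Int_Diff[of _ _ "vec.span {u}"]) auto
    also have "\<dots> = (\<Sum>v\<in>U \<inter> vec.span {u}. Q * Q ^ CARD('n)) + (\<Sum>v\<in>U - vec.span {u}. Q ^ CARD('n))"
      using c1 c2 by (intro arg_cong2[where f = "(+)"] sum.cong) auto
    also have "\<dots> = q * (Q * Q ^ CARD('n)) + (n - q) * Q ^ CARD('n)"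
    proof -
      have "real (card (U - vec.span {u})) = n - q"
        using card card_Diff_subset_Int[of U "vec.span {u}"] card_mono[of U "U \<inter> vec.span {u}"]
        by (simp add: n_def q_def of_nat_diff)
      then show ?thesis using card by (simp add: q_def)
    qed
    finally show ?thesis by (simp add: algebra_simps)
  qed
  have "Q\<^sup>2 * (\<Sum>f\<in>UNIV. (real (card {u \<in> U. dotp f u = 0}))\<^sup>2) = (\<Sum>u\<in>U. Q\<^sup>2 * (\<Sum>v\<in>U. c u v))"
    by (simp add: sum_card_kernel_power2 c_def sum_distrib_left)
  also have "\<dots> = Q\<^sup>2 * (\<Sum>v\<in>U. c 0 v) + (\<Sum>u\<in>U - {0}. Q\<^sup>2 * (\<Sum>v\<in>U. c u v))"
    using U(3) by (subst sum.remove[of _ 0]) auto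
  also have "\<dots> = Q ^ CARD('n) * (Q * (Q + n - 1)) + (\<Sum>u\<in>U - {0}. Q ^ CARD('n) * (q * Q + (n - q)))"
    using row0 row by (intro arg_cong2[where f = "(+)"] sum.cong) auto
  also have "\<dots> = Q ^ CARD('n) * (Q * (Q + n - 1) + (n - 1) * (q * Q + (n - q)))"
  proof -
    have "real (card (U - {0})) = n - 1"
      using U(3) card_gt_0_iff[of U] by (auto simp: n_def of_nat_diff Suc_le_eq)
    then show ?thesis
      unfolding sum_constant by (simp only: distrib_left mult.left_commute)
  qed
  finally show ?thesis .
qed

section \<open>Hyperplane sections of a maximum scattered set\<close>

text \<open>No power of \<open>b\<close> lies strictly between the consecutive powers with exponents
  \<open>d\<close> and \<open>d + 1\<close>, so the two factors never have opposite signs.\<close>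

lemma consecutive_power_product_nonneg:
  fixes b :: real
  assumes "1 < b" and "d \<le> t"
  shows "0 \<le> (b ^ t - b ^ d) * (b ^ t - b * b ^ d)"
    and "(b ^ t - b ^ d) * (b ^ t - b * b ^ d) = 0 \<Longrightarrow> t = d \<or> t = d + 1"
proof -
  consider "t = d" | "Suc d \<le> t" using assms(2) by linarith
  then show "0 \<le> (b ^ t - b ^ d) * (b ^ t - b * b ^ d)"
  proof cases
    case 2
    then have "b ^ Suc d \<le> b ^ t" and "b ^ d \<le> b ^ t"
      using assms by (intro power_increasing; simp)+
    then show ?thesis by simp
  qed simp
  assume "(b ^ t - b ^ d) * (b ^ t - b * b ^ d) = 0"
  then have "b ^ t = b ^ d \<or> b ^ t = b ^ Suc d" by auto
  then show "t = d \<or> t = d + 1"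
    using assms(1) by (simp only: power_inject_exp) auto
qed

text \<open>Blokhuis and Lavrauw: a maximum scattered set has only two hyperplane weights. The
  ambient hyperplane of \<open>U\<close> is $\ker g$.\<close>

lemma scattered_hyperplane_weight:
  fixes e :: "'q::{field,finite} \<Rightarrow> 'a::{field,finite}" and U :: "('a ^ 'n) set"
  assumes e: "field_embedding e" and Q: "CARD('a) = CARD('q) ^ m"
    and U: "Fq_subspace e U" "scattered e U"
    and dim: "2 * Fq_dim e U + m = CARD('n) * m"
    and g: "g \<noteq> 0" "\<And>u. u \<in> U \<Longrightarrow> dotp g u = 0"
    and f: "f \<notin> range (\<lambda>c. c *s g)"
  shows "weight e U {u. dotp f u = 0} + m \<in> {Fq_dim e U, Fq_dim e U + 1}"
proof -
  interpret F: vector_space "scale_via e :: 'q \<Rightarrow> 'a ^ 'n \<Rightarrow> 'a ^ 'n"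
    by (rule vector_space_scale_via[OF e])
  have zero: "0 \<in> U" using U(1) by (rule F.subspace_0)
  define d where "d = Fq_dim e U"
  define q where "q = real CARD('q)"
  define n where "n = q ^ d"
  define R where "R = q ^ m"
  define s where "s h = weight e U {u. dotp h u = 0}" for h
  have "card {0, 1 :: 'q} \<le> CARD('q)" by (intro card_mono) auto
  then have q: "1 < q" by (simp add: q_def)
  have n: "real (card U) = n"
    using card_Fq_subspace[OF e U(1)] by (simp add: n_def q_def d_def)
  have R: "real CARD('a) = R"
    using Q by (simp add: R_def q_def)
  have X: "card {u \<in> U. dotp h u = 0} = CARD('q) ^ s h" for h
    using card_Fq_subspace[OF e Fq_subspace_inter[OF e U(1)
          Fq_subspace_of_subspace[OF e subspace_kernel_dotp[of h]]]]
    by (simp add: s_def weight_def Int_def)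
  \<comment> \<open>\<open>q ^ (s h + m)\<close> is Q times the number of vectors of
    \<open>U\<close> killed by \<open>h\<close>, so \<open>P h\<close> is the summand of the double
    count.\<close>
  define P where "P h = (q ^ (s h + m) - q ^ d) * (q ^ (s h + m) - q * q ^ d)" for h
  \<comment> \<open>The values of \<open>h\<close> on \<open>U\<close> lie in a field with
    \<open>CARD('q) ^ m\<close> elements, so passing to the kernel loses at most \<open>m\<close>
    dimensions.\<close>
  have d_le: "d \<le> s h + m" for h
  proof -
    have "card U \<le> card {u \<in> U. dotp h u = 0} * card (dotp h ` U)"
      using U(1) by (intro card_le_card_kernel_mult_card_image) (auto simp: dotp_diff_right F.subspace_diff)
    also have "\<dots> \<le> CARD('q) ^ s h * CARD('q) ^ m"
      unfolding X by (intro mult_left_mono) (auto simp flip: Q intro: card_mono)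
    finally have "CARD('q) ^ d \<le> CARD('q) ^ (s h + m)"
      using card_Fq_subspace[OF e U(1)] by (simp add: d_def power_add)
    then show ?thesis
      using q by (simp add: q_def)
  qed
  have P_nonneg: "0 \<le> P h" for h
    unfolding P_def by (rule consecutive_power_product_nonneg(1)[OF q d_le])
  \<comment> \<open>Maximality enters here: the dimension \<open>d\<close> is exactly what makes the
    number of functionals equal to \<open>R * n\<^sup>2\<close>.\<close>
  have Rk: "R ^ CARD('n) = R * n\<^sup>2"
  proof -
    have "R ^ CARD('n) = q ^ (2 * d + m)"
      using dim by (simp add: R_def d_def mult.commute flip: power_mult)
    then show ?thesis
      by (simp add: R_def n_def power_add power_even_eq)
  qed
  \<comment> \<open>Expanding \<open>P\<close> leaves the second moment, the first moment and the
    number of functionals. After division by \<open>R * n\<^sup>2\<close> all terms in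
    \<open>n\<close> cancel and \<open>(R - 1) * (R - q)\<close> remains.\<close>
  have P_sum: "(\<Sum>h\<in>UNIV. P h) = R * ((R * n - n) * (R * n - q * n))"
  proof -
    define X where "X h = real (card {u \<in> U. dotp h u = 0})" for h
    have "P h = R\<^sup>2 * (X h)\<^sup>2 - (q + 1) * n * (R * X h) + q * n\<^sup>2" for h
      by (simp add: P_def X_def X n_def R_def power_add q_def power2_eq_square algebra_simps)
    then have "(\<Sum>h\<in>UNIV. P h) = R\<^sup>2 * (\<Sum>h\<in>UNIV. (X h)\<^sup>2)
        - (q + 1) * n * (R * (\<Sum>h\<in>UNIV. X h)) + q * n\<^sup>2 * real CARD('a ^ 'n)"
      by (simp add: sum.distrib sum_subtractf sum_distrib_left mult.assoc)
    also have "R\<^sup>2 * (\<Sum>h\<in>UNIV. (X h)\<^sup>2) =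
        R * n\<^sup>2 * (R * (R + n - 1) + (n - 1) * (q * R + (n - q)))"
      using scattered_sum_card_kernel_power2[OF e U zero] by (simp only: X_def R n Rk q_def)
    also have "R * (\<Sum>h\<in>UNIV. X h) = R * n\<^sup>2 * (R + n - 1)"
      using sum_card_kernel[OF zero] by (simp only: X_def R n Rk)
    also have "real CARD('a ^ 'n) = R * n\<^sup>2"
      by (simp add: R Rk)
    finally show ?thesis
      by (simp add: power2_eq_square algebra_simps)
  qed
  \<comment> \<open>Multiples of \<open>g\<close> vanish on all of \<open>U\<close>, and there are
    \<open>R\<close> of them since \<open>g\<close> is nonzero. They already account for the whole
    sum.\<close>
  have P_multiples: "(\<Sum>h\<in>range (\<lambda>c. c *s g). P h) = R * ((R * n - n) * (R * n - q * n))"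
  proof -
    have "P h = (R * n - n) * (R * n - q * n)" if "h \<in> range (\<lambda>c. c *s g)" for h
    proof -
      have "{u \<in> U. dotp h u = 0} = U"
        using that g(2) by (auto simp: dotp_scale_left)
      then have "q ^ s h = n"
        using X[of h] n by (simp add: q_def)
      then show ?thesis
        by (simp add: P_def power_add R_def mult.commute flip: n_def)
    qed
    moreover have "card (range (\<lambda>c. c *s g)) = CARD('a)"
      using g(1) by (intro card_image) (auto simp: inj_on_def)
    ultimately show ?thesis by (simp add: R)
  qed
  have "(\<Sum>h\<in>- range (\<lambda>c. c *s g). P h) = 0"
    using P_sum P_multiples sum.subset_diff[of "range (\<lambda>c. c *s g)" UNIV P]
    by (simp add: Compl_eq_Diff_UNIV)
  then have "P f = 0"
    using f P_nonneg by (subst (asm) sum_nonneg_eq_0_iff) auto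
  then show ?thesis
    using consecutive_power_product_nonneg(2)[OF q d_le[of f]] by (simp add: P_def s_def d_def)
qed

section \<open>Hyperplane weights of the sum of \<open>U'\<close> and \<open>U''\<close>\<close>

theorem theorem5p6:
  fixes e :: "'q::{field,finite} \<Rightarrow> 'a::{field,finite}"
    and q k m i :: nat
    and W U' U'' U :: "('a ^ 'n) set"
    and x :: "'a ^ 'n"
  assumes "primepow q" and "k > 0" and "m > 0" and "even ((k - 1) * m)"
    and "CARD('q) = q" and "CARD('a) = q ^ m" and "CARD('n) = k"
    and "field_embedding e"
    and "vec.subspace W" and "vec.dim W = k - 1"
    and "Fq_subspace e U'" and "U' \<subseteq> W" and "maximum_scattered_in e m W U'"
    and "vec.span {x} \<inter> W = {0}"
    and "i > 0" and "real i \<ge> real m / 2"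
    and "Fq_subspace e U''" and "U'' \<subseteq> vec.span {x}" and "Fq_dim e U'' = i"
    and "U = {u + v | u v. u \<in> U' \<and> v \<in> U''}"
  shows "(\<forall>\<Omega> :: ('a ^ 'n) set. proj_hyperplane \<Omega> \<longrightarrow>
            real (weight e U \<Omega>) \<in>
              insert (real m * (real k - 1) / 2)
                {real m * (real k - 3) / 2 + real j | j. j \<le> i + 1}) \<and>
         (\<exists>\<Omega> :: ('a ^ 'n) set. proj_hyperplane \<Omega> \<and>
            real (weight e U \<Omega>) = real m * (real k - 1) / 2)"
proof -
  have e: "field_embedding e" and W: "vec.subspace W" "vec.dim W = k - 1"
    and U': "Fq_subspace e U'" "U' \<subseteq> W" "scattered e U'"
    and U'': "Fq_subspace e U''" "U'' \<subseteq> vec.span {x}" "Fq_dim e U'' = i"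
    and Udef: "U = {u + v | u v. u \<in> U' \<and> v \<in> U''}"
    using assms by (auto simp: maximum_scattered_in_def)
  interpret F: vector_space "scale_via e :: 'q \<Rightarrow> 'a ^ 'n \<Rightarrow> 'a ^ 'n"
    by (rule vector_space_scale_via[OF e])
  have "card {0, 1 :: 'q} \<le> CARD('q)" by (intro card_mono) auto
  then have q: "1 < CARD('q)" by simp
  define d where "d = Fq_dim e U'"
  have d: "real d = real m * (real k - 1) / 2"
    using assms by (simp add: d_def maximum_scattered_in_def of_nat_diff)
  have dim: "2 * d + m = CARD('n) * m"
  proof -
    have "real (2 * d + m) = real (CARD('n) * m)"
      using d assms(7) by (simp add: field_simps)
    then show ?thesis by (simp only: of_nat_eq_iff)
  qed
  \<comment> \<open>The trivial intersection alone would allow \<open>x = 0\<close>; this is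
    excluded because \<open>U''\<close> has positive dimension \<open>i\<close> inside the span of
    \<open>x\<close>.\<close>
  have "x \<notin> W"
  proof
    assume "x \<in> W"
    then have "x = 0" using assms(14) vec.span_base[of x "{x}"] by blast
    then have "card U'' \<le> card {0 :: 'a ^ 'n}" using U''(2) by (intro card_mono) auto
    moreover have "card U'' = CARD('q) ^ i" using card_Fq_subspace[OF e U''(1)] U''(3) by simp
    moreover have "1 < CARD('q) ^ i" using q assms(15) by (rule one_less_power)
    ultimately show False by simp
  qed
  \<comment> \<open>\<open>g\<close> reads off the coefficient of \<open>x\<close> modulo
    \<open>W\<close>: it vanishes on \<open>U'\<close> and is injective on
    \<open>U''\<close>.\<close>
  then obtain g where gW: "\<And>w. w \<in> W \<Longrightarrow> dotp g w = 0" and gx: "dotp g x = 1"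
    using separating_functional_exists[OF W(1)] by blast
  have g0: "g \<noteq> 0" using gx by auto
  have hypW: "proj_hyperplane W"
    using W assms(7) by (simp add: proj_hyperplane_def)
  have gU'': "v = 0" if "v \<in> U''" "dotp g v = 0" for v
    using that U''(2) gx by (auto simp: vec.span_singleton dotp_scale_right)
  have U'_sub: "U' \<subseteq> U"
  proof
    fix u assume "u \<in> U'"
    moreover have "0 \<in> U''" using U''(1) by (rule F.subspace_0)
    moreover have "u = u + 0" by simp
    ultimately show "u \<in> U" unfolding Udef by blast
  qed
  have kerU: "z \<in> U'" if zU: "z \<in> U" and gz: "dotp g z = 0" for z
  proof -
    obtain u v where z: "z = u + v" "u \<in> U'" "v \<in> U''" using zU Udef by blast
    then have "dotp g v = 0"
      using gz gW U'(2) by (auto simp: dotp_add_right)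
    with z gU''[of v] show ?thesis by simp
  qed
  have "U \<inter> W = U'"
    using kerU gW U'_sub U'(2) by blast
  then have weightW: "weight e U W = d"
    by (simp add: weight_def d_def)
  have U: "Fq_subspace e U"
    unfolding Udef using F.subspace_sums[OF U'(1) U''(1)] .
  \<comment> \<open>Adding \<open>m\<close> on the left avoids the truncated \<open>d - m\<close>.
    On the right, \<open>i\<close> comes from \<open>U''\<close> and the extra 1 from the larger of
    the two weights of \<open>U'\<close>.\<close>
  have range: "d \<le> weight e U \<Omega> + m \<and> weight e U \<Omega> + m \<le> d + i + 1"
    if \<Omega>: "proj_hyperplane \<Omega>" "\<Omega> \<noteq> W" for \<Omega> :: "('a ^ 'n) set"
  proof -
    have \<Omega>_sub: "vec.subspace \<Omega>" and \<Omega>_dim: "vec.dim \<Omega> = vec.dim W"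
      using \<Omega>(1) W assms(7) by (auto simp: proj_hyperplane_def)
    have \<Omega>_Fq: "Fq_subspace e \<Omega>"
      by (rule Fq_subspace_of_subspace[OF e \<Omega>_sub])
    obtain f where f: "\<Omega> = {u. dotp f u = 0}" "f \<noteq> 0"
      using hyperplane_eq_kernel[OF \<Omega>(1)] by blast
    \<comment> \<open>A multiple of \<open>g\<close> would vanish on \<open>W\<close>, and equality
      of dimensions would force \<Omega> to be \<open>W\<close>.\<close>
    have "f \<notin> range (\<lambda>c. c *s g)"
    proof
      assume "f \<in> range (\<lambda>c. c *s g)"
      then have "W \<subseteq> \<Omega>" using f gW by (auto simp: dotp_scale_left)
      then have "W = \<Omega>"
        using \<Omega>_dim by (intro vec.subspace_dim_equal[OF W(1) \<Omega>_sub]) auto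
      with \<Omega>(2) show False by simp
    qed
    then have s: "weight e U' \<Omega> + m \<in> {d, d + 1}"
      unfolding f(1) d_def
      using assms(5,6) dim gW U'(2)
      by (intro scattered_hyperplane_weight[OF e _ U'(1,3) _ g0]) (auto simp: d_def)
    have cardU: "card (U \<inter> \<Omega>) = CARD('q) ^ weight e U \<Omega>"
      using card_Fq_subspace[OF e Fq_subspace_inter[OF e U \<Omega>_Fq]] by (simp add: weight_def)
    have cardU': "card (U' \<inter> \<Omega>) = CARD('q) ^ weight e U' \<Omega>"
      using card_Fq_subspace[OF e Fq_subspace_inter[OF e U'(1) \<Omega>_Fq]] by (simp add: weight_def)
    have "card (U' \<inter> \<Omega>) \<le> card (U \<inter> \<Omega>)"
      using U'_sub by (intro card_mono) auto
    then have lower: "weight e U' \<Omega> \<le> weight e U \<Omega>"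
      using q by (simp add: cardU cardU')
    \<comment> \<open>Apply \<open>g\<close> to the section: its kernel there lies in
      \<open>U'\<close>, and its values are already taken on \<open>U''\<close> because the
      \<open>U'\<close> component is killed.\<close>
    have "card (U \<inter> \<Omega>) \<le> card {z \<in> U \<inter> \<Omega>. dotp g z = 0} * card (dotp g ` (U \<inter> \<Omega>))"
      using U \<Omega>_sub
      by (intro card_le_card_kernel_mult_card_image)
        (auto simp: dotp_diff_right F.subspace_diff vec.subspace_diff)
    also have "\<dots> \<le> card (U' \<inter> \<Omega>) * card (dotp g ` U'')"
    proof (intro mult_mono card_mono)
      show "{z \<in> U \<inter> \<Omega>. dotp g z = 0} \<subseteq> U' \<inter> \<Omega>" using kerU by blast
      show "dotp g ` (U \<inter> \<Omega>) \<subseteq> dotp g ` U''"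
        using gW U'(2) by (force simp: Udef dotp_add_right)
    qed auto
    also have "\<dots> \<le> card (U' \<inter> \<Omega>) * card U''"
      by (intro mult_left_mono card_image_le) auto
    also have "\<dots> = CARD('q) ^ (weight e U' \<Omega> + i)"
      using card_Fq_subspace[OF e U''(1)] U''(3) cardU' by (simp add: power_add)
    finally have "weight e U \<Omega> \<le> weight e U' \<Omega> + i"
      using q by (simp add: cardU)
    with lower s show ?thesis by auto
  qed
  have "real (weight e U \<Omega>) \<in> insert (real m * (real k - 1) / 2)
      {real m * (real k - 3) / 2 + real j | j. j \<le> i + 1}"
    if \<Omega>: "proj_hyperplane \<Omega>" for \<Omega> :: "('a ^ 'n) set"
  proof (cases "\<Omega> = W")
    case True
    then show ?thesis using weightW d by simp
  next
    case False
    \<comment> \<open>The offset from d - m = m(k-3)/2, a number that is negative for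
      \<open>k < 3\<close> and hence handled in the reals; the subtraction in \<open>j\<close> is
      exact by the lower bound in \<open>range\<close>.\<close>
    define j where "j = weight e U \<Omega> + m - d"
    have "j \<le> i + 1" and "real (weight e U \<Omega>) = real d - real m + real j"
      using range[OF \<Omega> False] by (auto simp: j_def of_nat_diff)
    moreover have "real d - real m = real m * (real k - 3) / 2"
      using d by (simp add: field_simps)
    ultimately show ?thesis by auto
  qed
  then show ?thesis
    using hypW weightW d by auto
qed

end
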